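(* Let $X$ be a real normed space with $\dim X\ge 2$, $\lambda\in\Lambda$, and $p\in[1,\infty]$. Then $$\mathfrak{C}_{\lambda,p}(X)=\max\{A_{\lambda,p}(X),B_{\lambda,p}(X)\},$$ where $$A_{\lambda,p}(X)=\sup_{u,v\in S_X,\ 0\le t\le1}\frac{\lambda(\|u+tv\|,\|tu-v\|)}{\|(1,t)\|_p},\qquad B_{\lambda,p}(X)=\sup_{u,v\in S_X,\ 0\le t\le1}\frac{\lambda(\|tu+v\|,\|u-tv\|)}{\|(1,t)\|_p}.$$ If $\lambda$ is symmetric (i.e. $\lambda(a,b)=\lambda(b,a)$), then $A_{\lambda,p}(X)=B_{\lambda,p}(X)$, and hence $$\mathfrak{C}_{\lambda,p}(X)=\sup_{u,v\in S_X,\ 0\le t\le1}\frac{\lambda(\|u+tv\|,\|tu-v\|)}{\|(1,t)\|_p}.$$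
   Context: $\Lambda$ is the class of all continuous functions $\lambda:[0,\infty)^2\to[0,\infty)$ that are homogeneous of degree one and satisfy $\lambda(1,1)=1$. $S_X$ is the unit sphere of $X$. For $(r,s)\in\mathbb{R}^2$, $\|(r,s)\|_p=(|r|^p+|s|^p)^{1/p}$ if $1\le p<\infty$ and $\|(r,s)\|_\infty=\max\{|r|,|s|\}$. Define $$\mathfrak{C}_{\lambda,p}(X)=\sup\{\lambda(\|ru+sv\|,\|su-rv\|):u,v\in S_X,\ r,s\ge0,\ \|(r,s)\|_p=1\}.$$ *)

theory Defs
  imports "HOL-Analysis.Analysis"
begin

(* Elements of the class are functions on the closed first quadrant; they are
   represented by total functions whose values off the quadrant are irrelevant. *)
definition Lambda_class :: "(real \<times> real \<Rightarrow> real) set" where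
  "Lambda_class = {l.
     continuous_on ({0..} \<times> {0..}) l \<and>
     (\<forall>a\<ge>0. \<forall>b\<ge>0. l (a, b) \<ge> 0) \<and>
     (\<forall>c\<ge>0. \<forall>a\<ge>0. \<forall>b\<ge>0. l (c * a, c * b) = c * l (a, b)) \<and>
     l (1, 1) = 1}"

definition symmetric_on_quadrant :: "(real \<times> real \<Rightarrow> real) \<Rightarrow> bool" where
  "symmetric_on_quadrant l \<longleftrightarrow> (\<forall>a\<ge>0. \<forall>b\<ge>0. l (a, b) = l (b, a))"

definition pnorm :: "ereal \<Rightarrow> real \<times> real \<Rightarrow> real" where
  "pnorm p = (\<lambda>(r, s).
     if p = \<infinity> then max \<bar>r\<bar> \<bar>s\<bar>
     else (\<bar>r\<bar> powr real_of_ereal p + \<bar>s\<bar> powr real_of_ereal p) powr (1 / real_of_ereal p))"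

(* Not expressed through dim, which is 0 on infinite-dimensional spaces. *)
definition dim_at_least :: "nat \<Rightarrow> 'a::real_vector itself \<Rightarrow> bool" where
  "dim_at_least n X \<longleftrightarrow> (\<exists>B::'a set. independent B \<and> finite B \<and> card B = n)"

(* The suprema below are taken in the reals; see the bdd_above lemmas at the end. *)
definition C_const :: "(real \<times> real \<Rightarrow> real) \<Rightarrow> ereal \<Rightarrow> 'a::real_normed_vector itself \<Rightarrow> real" where
  "C_const l p X = Sup {l (norm (r *\<^sub>R u + s *\<^sub>R v), norm (s *\<^sub>R u - r *\<^sub>R v)) | (u::'a) v r s.
     u \<in> sphere 0 1 \<and> v \<in> sphere 0 1 \<and> 0 \<le> r \<and> 0 \<le> s \<and> pnorm p (r, s) = 1}"

definition A_const :: "(real \<times> real \<Rightarrow> real) \<Rightarrow> ereal \<Rightarrow> 'a::real_normed_vector itself \<Rightarrow> real" where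
  "A_const l p X = Sup {l (norm (u + t *\<^sub>R v), norm (t *\<^sub>R u - v)) / pnorm p (1, t) | (u::'a) v t.
     u \<in> sphere 0 1 \<and> v \<in> sphere 0 1 \<and> 0 \<le> t \<and> t \<le> 1}"

definition B_const :: "(real \<times> real \<Rightarrow> real) \<Rightarrow> ereal \<Rightarrow> 'a::real_normed_vector itself \<Rightarrow> real" where
  "B_const l p X = Sup {l (norm (t *\<^sub>R u + v), norm (u - t *\<^sub>R v)) / pnorm p (1, t) | (u::'a) v t.
     u \<in> sphere 0 1 \<and> v \<in> sphere 0 1 \<and> 0 \<le> t \<and> t \<le> 1}"

lemma Lambda_class_bounded:
  assumes "l \<in> Lambda_class"
  obtains M where "0 \<le> M" "\<And>a b. 0 \<le> a \<Longrightarrow> a \<le> 2 \<Longrightarrow> 0 \<le> b \<Longrightarrow> b \<le> 2 \<Longrightarrow> l (a, b) \<le> M"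
proof -
  have "continuous_on ({0..} \<times> {0..}) l"
    using assms by (simp add: Lambda_class_def)
  then have "continuous_on ({0..2} \<times> {0..2}) l"
    by (rule continuous_on_subset) auto
  then have "bounded (l ` ({0..2} \<times> {0..2}))"
    by (intro compact_imp_bounded compact_continuous_image compact_Times compact_Icc)
  then obtain M where M: "\<And>x. x \<in> {0..2} \<times> {0..2} \<Longrightarrow> \<bar>l x\<bar> \<le> M"
    by (auto simp: bounded_iff)
  show thesis
  proof (rule that[of "max 0 M"])
    fix a b :: real assume "0 \<le> a" "a \<le> 2" "0 \<le> b" "b \<le> 2"
    then show "l (a, b) \<le> max 0 M" using M[of "(a, b)"] by auto
  qed simp
qed

lemma pnorm_ge:
  assumes "1 \<le> p"
  shows "\<bar>r\<bar> \<le> pnorm p (r, s)" and "\<bar>s\<bar> \<le> pnorm p (r, s)"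
proof -
  have *: "\<bar>x\<bar> \<le> (\<bar>x\<bar> powr q + \<bar>y\<bar> powr q) powr (1 / q)" if "1 \<le> q" for x y q :: real
  proof -
    have "\<bar>x\<bar> = (\<bar>x\<bar> powr q) powr (1 / q)" using that by (simp add: powr_powr)
    also have "\<dots> \<le> (\<bar>x\<bar> powr q + \<bar>y\<bar> powr q) powr (1 / q)"
      using that by (intro powr_mono2) auto
    finally show ?thesis .
  qed
  have q: "1 \<le> real_of_ereal p" if "p \<noteq> \<infinity>"
    using assms that by (cases p) (auto simp: one_ereal_def)
  show "\<bar>r\<bar> \<le> pnorm p (r, s)" "\<bar>s\<bar> \<le> pnorm p (r, s)"
    using *[OF q, of r s] *[OF q, of s r] by (auto simp: pnorm_def add.commute)
qed

lemma norm_comb_le_2: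
  fixes u v :: "'a::real_normed_vector"
  assumes "norm u = 1" "norm v = 1" "0 \<le> r" "r \<le> 1" "0 \<le> s" "s \<le> 1"
  shows "norm (r *\<^sub>R u + s *\<^sub>R v) \<le> 2" and "norm (r *\<^sub>R u - s *\<^sub>R v) \<le> 2"
  using norm_triangle_ineq[of "r *\<^sub>R u" "s *\<^sub>R v"] norm_triangle_ineq4[of "r *\<^sub>R u" "s *\<^sub>R v"] assms
  by auto

lemma bdd_above_C_const:
  assumes "l \<in> Lambda_class" "1 \<le> p"
  shows "bdd_above {l (norm (r *\<^sub>R u + s *\<^sub>R v), norm (s *\<^sub>R u - r *\<^sub>R v)) | (u::'a::real_normed_vector) v r s.
     u \<in> sphere 0 1 \<and> v \<in> sphere 0 1 \<and> 0 \<le> r \<and> 0 \<le> s \<and> pnorm p (r, s) = 1}"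
proof -
  obtain M where M: "\<And>a b. 0 \<le> a \<Longrightarrow> a \<le> 2 \<Longrightarrow> 0 \<le> b \<Longrightarrow> b \<le> 2 \<Longrightarrow> l (a, b) \<le> M"
    using Lambda_class_bounded[OF assms(1)] by blast
  have "l (norm (r *\<^sub>R u + s *\<^sub>R v), norm (s *\<^sub>R u - r *\<^sub>R v)) \<le> M"
    if "norm u = 1" "norm v = 1" "0 \<le> r" "0 \<le> s" "pnorm p (r, s) = 1" for u v :: 'a and r s
    using that pnorm_ge[OF assms(2), of r s] pnorm_ge[OF assms(2), of s r]
    by (intro M norm_comb_le_2) auto
  then show ?thesis by (intro bdd_aboveI[of _ M]) auto
qed

lemma bdd_above_AB_const:
  assumes "l \<in> Lambda_class" "1 \<le> p"
  shows "bdd_above {l (norm (u + t *\<^sub>R v), norm (t *\<^sub>R u - v)) / pnorm p (1, t) | (u::'a::real_normed_vector) v t.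
     u \<in> sphere 0 1 \<and> v \<in> sphere 0 1 \<and> 0 \<le> t \<and> t \<le> 1}" (is ?A)
    and "bdd_above {l (norm (t *\<^sub>R u + v), norm (u - t *\<^sub>R v)) / pnorm p (1, t) | (u::'a::real_normed_vector) v t.
     u \<in> sphere 0 1 \<and> v \<in> sphere 0 1 \<and> 0 \<le> t \<and> t \<le> 1}" (is ?B)
proof -
  obtain M where M0: "0 \<le> M"
    and M: "\<And>a b. 0 \<le> a \<Longrightarrow> a \<le> 2 \<Longrightarrow> 0 \<le> b \<Longrightarrow> b \<le> 2 \<Longrightarrow> l (a, b) \<le> M"
    using Lambda_class_bounded[OF assms(1)] by blast
  have quot: "x / pnorm p (1, t) \<le> M" if "x \<le> M" for x t
  proof -
    have "1 \<le> pnorm p (1, t)" using pnorm_ge(1)[OF assms(2), of 1 t] by simp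
    then have "M \<le> M * pnorm p (1, t)" using M0 by (simp add: mult_le_cancel_left1)
    then show ?thesis using that \<open>1 \<le> pnorm p (1, t)\<close> by (simp add: divide_le_eq)
  qed
  have "l (norm (u + t *\<^sub>R v), norm (t *\<^sub>R u - v)) \<le> M"
       "l (norm (t *\<^sub>R u + v), norm (u - t *\<^sub>R v)) \<le> M"
    if "norm u = 1" "norm v = 1" "0 \<le> t" "t \<le> 1" for u v :: 'a and t
    using that norm_comb_le_2[of u v 1 t] norm_comb_le_2[of u v t 1]
    by (auto intro!: M)
  then show ?A ?B by (auto intro!: bdd_aboveI[of _ M] quot)
qed

end

theory Submission
  imports Defs
begin

text \<open>If \<open>pnorm p (r, s) = 1\<close>, pulling the larger of \<open>r\<close>, \<open>s\<close> out of \<open>l\<close> by homogeneity leaves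
  the ratio \<open>t \<in> [0, 1]\<close>, and the factor pulled out is \<open>1 / pnorm p (1, t)\<close>; the cases \<open>s \<le> r\<close>
  and \<open>r \<le> s\<close> give exactly the values in the suprema for \<open>A\<close> and \<open>B\<close>. For symmetric \<open>l\<close>,
  replacing \<open>v\<close> by \<open>-v\<close> exchanges these two sets of values.\<close>

lemma pnorm_commute: "pnorm p (r, s) = pnorm p (s, r)"
  by (simp add: pnorm_def add.commute max.commute)

lemma pnorm_scale:
  assumes "1 \<le> p" "0 \<le> c"
  shows "pnorm p (c * r, c * s) = c * pnorm p (r, s)"
proof (cases "p = \<infinity>")
  case True
  then show ?thesis using assms(2) by (simp add: pnorm_def abs_mult max_mult_distrib_left)
next
  case False
  define q where "q = real_of_ereal p"
  have "1 \<le> q" using assms(1) False unfolding q_def by (cases p) (auto simp: one_ereal_def)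
  have "(\<bar>c * r\<bar> powr q + \<bar>c * s\<bar> powr q) powr (1 / q)
      = (c powr q * (\<bar>r\<bar> powr q + \<bar>s\<bar> powr q)) powr (1 / q)"
    using assms(2) by (simp add: abs_mult powr_mult distrib_left)
  \<comment> \<open>As \<open>q\<close> is nonzero and \<open>c\<close> nonnegative, the outer
    exponent cancels \<open>q\<close> on \<open>c\<close>. This includes \<open>c = 0\<close>,
    because \<open>0 powr x = 0\<close>.\<close>
  also have "\<dots> = c * (\<bar>r\<bar> powr q + \<bar>s\<bar> powr q) powr (1 / q)"
    using assms(2) \<open>1 \<le> q\<close> by (simp add: powr_mult powr_powr)
  finally show ?thesis using False by (simp add: pnorm_def q_def)
qed

lemma Lambda_class_scale_norm:
  fixes x y :: "'a::real_normed_vector"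
  assumes "l \<in> Lambda_class" "0 \<le> c"
  shows "l (norm (c *\<^sub>R x), norm (c *\<^sub>R y)) = c * l (norm x, norm y)"
  using assms by (simp add: Lambda_class_def)

text \<open>The dimension assumption enters the theorem here: a unit vector makes the sets under the
  suprema nonempty.\<close>

lemma dim_at_least_unit_vector:
  assumes "dim_at_least n TYPE('a::real_normed_vector)" "0 < n"
  obtains x :: "'a::real_normed_vector" where "norm x = 1"
proof -
  obtain B :: "'a set" where B: "independent B" "card B = n"
    using assms(1) unfolding dim_at_least_def by blast
  then obtain x where "x \<in> B" using assms(2) by fastforce
  with B(1) have "x \<noteq> 0" using dependent_zero by blast
  then show thesis by (intro that[of "x /\<^sub>R norm x"]) simp
qed

text \<open>Naming the sets under the three suprema lets the identities be proved between sets,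
  before any supremum is taken.\<close>

definition C_set :: "(real \<times> real \<Rightarrow> real) \<Rightarrow> ereal \<Rightarrow> 'a::real_normed_vector itself \<Rightarrow> real set" where
  "C_set l p X = {l (norm (r *\<^sub>R u + s *\<^sub>R v), norm (s *\<^sub>R u - r *\<^sub>R v)) | (u::'a) v r s.
     u \<in> sphere 0 1 \<and> v \<in> sphere 0 1 \<and> 0 \<le> r \<and> 0 \<le> s \<and> pnorm p (r, s) = 1}"

definition A_set :: "(real \<times> real \<Rightarrow> real) \<Rightarrow> ereal \<Rightarrow> 'a::real_normed_vector itself \<Rightarrow> real set" where
  "A_set l p X = {l (norm (u + t *\<^sub>R v), norm (t *\<^sub>R u - v)) / pnorm p (1, t) | (u::'a) v t.
     u \<in> sphere 0 1 \<and> v \<in> sphere 0 1 \<and> 0 \<le> t \<and> t \<le> 1}"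

definition B_set :: "(real \<times> real \<Rightarrow> real) \<Rightarrow> ereal \<Rightarrow> 'a::real_normed_vector itself \<Rightarrow> real set" where
  "B_set l p X = {l (norm (t *\<^sub>R u + v), norm (u - t *\<^sub>R v)) / pnorm p (1, t) | (u::'a) v t.
     u \<in> sphere 0 1 \<and> v \<in> sphere 0 1 \<and> 0 \<le> t \<and> t \<le> 1}"

text \<open>Both inclusions keep \<open>u\<close> and \<open>v\<close> and change only the
  coefficients: forward, \<open>(r, s)\<close> is divided by its larger entry; backward,
  \<open>(1, t)\<close> or \<open>(t, 1)\<close> is divided by its norm.\<close>

lemma C_set_eq_Un:
  assumes l: "l \<in> Lambda_class" and p: "1 \<le> p"
  shows "C_set l p X = A_set l p X \<union> B_set l p (X :: 'a::real_normed_vector itself)"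
proof (intro equalityI subsetI)
  fix x assume "x \<in> C_set l p X"
  then obtain u v :: 'a and r s where uv: "u \<in> sphere 0 1" "v \<in> sphere 0 1"
    and rs: "0 \<le> r" "0 \<le> s" "pnorm p (r, s) = 1"
    and x: "x = l (norm (r *\<^sub>R u + s *\<^sub>R v), norm (s *\<^sub>R u - r *\<^sub>R v))"
    unfolding C_set_def by blast
  \<comment> \<open>Scaling by 0 gives \<open>pnorm p (0, 0) = 0\<close>, which contradicts the norm
    being 1.\<close>
  have nz: "r \<noteq> 0 \<or> s \<noteq> 0"
    using pnorm_scale[OF p, of 0 0 0] rs(3) by auto
  show "x \<in> A_set l p X \<union> B_set l p X"
  proof (cases "s \<le> r")
    case True
    with nz rs have r: "0 < r" by auto
    define t where "t = s / r"
    have s: "s = r * t" using r by (simp add: t_def)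
    \<comment> \<open>This equation also shows that the denominator \<open>pnorm p (1, t)\<close> is
      nonzero.\<close>
    have "r * pnorm p (1, t) = 1"
      using rs(3) pnorm_scale[OF p rs(1), of 1 t] by (simp add: s)
    then have "r = 1 / pnorm p (1, t)" by (intro eq_divide_imp) auto
    \<comment> \<open>Homogeneity is read backwards: the factor \<open>r\<close> moves into both
      norms, where \<open>r * t\<close> is \<open>s\<close>.\<close>
    moreover have "x = r * l (norm (u + t *\<^sub>R v), norm (t *\<^sub>R u - v))"
      unfolding x s Lambda_class_scale_norm[OF l rs(1), symmetric] by (simp add: algebra_simps)
    moreover have "0 \<le> t" "t \<le> 1" using True r rs by (auto simp: t_def)
    ultimately show ?thesis using uv unfolding A_set_def by force
  next
    case False
    with nz rs have r: "0 < s" by auto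
    \<comment> \<open>The mirror case: the facts named \<open>r\<close> and \<open>s\<close> now
      speak of \<open>s\<close> and \<open>r\<close>, and \<open>pnorm_commute\<close> turns
      \<open>(t, 1)\<close> into \<open>(1, t)\<close>.\<close>
    define t where "t = r / s"
    have s: "r = s * t" using r by (simp add: t_def)
    have "s * pnorm p (1, t) = 1"
      using rs(3) pnorm_scale[OF p rs(2), of 1 t] by (simp add: s pnorm_commute)
    then have "s = 1 / pnorm p (1, t)" by (intro eq_divide_imp) auto
    moreover have "x = s * l (norm (t *\<^sub>R u + v), norm (u - t *\<^sub>R v))"
      unfolding x s Lambda_class_scale_norm[OF l rs(2), symmetric] by (simp add: algebra_simps)
    moreover have "0 \<le> t" "t \<le> 1" using False r rs by (auto simp: t_def)
    ultimately show ?thesis using uv unfolding B_set_def by force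
  qed
next
  \<comment> \<open>For the converse, \<open>1 \<le> pnorm p (1, t)\<close> permits normalising
    \<open>(1, t)\<close>.\<close>
  have norm1: "0 < 1 / pnorm p (1, t)" "pnorm p (1 / pnorm p (1, t), t / pnorm p (1, t)) = 1"
    for t
  proof -
    have "1 \<le> pnorm p (1, t)" using pnorm_ge(1)[OF p, of 1 t] by simp
    then show "0 < 1 / pnorm p (1, t)" by simp
    with pnorm_scale[OF p, of "1 / pnorm p (1, t)" 1 t]
    show "pnorm p (1 / pnorm p (1, t), t / pnorm p (1, t)) = 1" by simp
  qed
  fix x assume "x \<in> A_set l p X \<union> B_set l p X"
  then consider
    u v :: 'a and t where "u \<in> sphere 0 1" "v \<in> sphere 0 1" "0 \<le> t"
      "x = 1 / pnorm p (1, t) * l (norm (u + t *\<^sub>R v), norm (t *\<^sub>R u - v))"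
  | u v :: 'a and t where "u \<in> sphere 0 1" "v \<in> sphere 0 1" "0 \<le> t"
      "x = 1 / pnorm p (1, t) * l (norm (t *\<^sub>R u + v), norm (u - t *\<^sub>R v))"
    unfolding A_set_def B_set_def by auto
  then show "x \<in> C_set l p X"
  proof cases
    case 1
    \<comment> \<open>The witness for \<open>(r, s)\<close> is \<open>(c, t * c)\<close>, the
      normalised \<open>(1, t)\<close>.\<close>
    define c where "c = 1 / pnorm p (1, t)"
    have c: "0 < c" "pnorm p (c, t * c) = 1" using norm1[of t] by (auto simp: c_def)
    have "x = l (norm (c *\<^sub>R u + (t * c) *\<^sub>R v), norm ((t * c) *\<^sub>R u - c *\<^sub>R v))"
      unfolding 1(4) c_def[symmetric] Lambda_class_scale_norm[OF l less_imp_le[OF c(1)], symmetric]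
      by (simp add: algebra_simps)
    moreover have "0 \<le> c" "0 \<le> t * c" using c 1 by auto
    ultimately show ?thesis unfolding C_set_def using 1 c(2) by blast
  next
    case 2
    \<comment> \<open>Here the witness is \<open>(t * c, c)\<close>, the normalised
      \<open>(t, 1)\<close>.\<close>
    define c where "c = 1 / pnorm p (1, t)"
    have c: "0 < c" "pnorm p (t * c, c) = 1"
      using norm1[of t] by (auto simp: c_def pnorm_commute)
    have "x = l (norm ((t * c) *\<^sub>R u + c *\<^sub>R v), norm (c *\<^sub>R u - (t * c) *\<^sub>R v))"
      unfolding 2(4) c_def[symmetric] Lambda_class_scale_norm[OF l less_imp_le[OF c(1)], symmetric]
      by (simp add: algebra_simps)
    moreover have "0 \<le> c" "0 \<le> t * c" using c 2 by auto
    ultimately show ?thesis unfolding C_set_def using 2 c(2) by blast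
  qed
qed

lemma A_set_eq_B_set:
  assumes "symmetric_on_quadrant l"
  shows "A_set l p X = B_set l p (X :: 'a::real_normed_vector itself)"
proof -
  have sym: "l (norm x, norm y) = l (norm y, norm x)" for x y :: 'a
    using assms by (simp add: symmetric_on_quadrant_def)
  show ?thesis
  proof (intro equalityI subsetI)
    fix x assume "x \<in> A_set l p X"
    then obtain u v :: 'a and t where uvt: "u \<in> sphere 0 1" "v \<in> sphere 0 1" "0 \<le> t" "t \<le> 1"
      and x: "x = l (norm (u + t *\<^sub>R v), norm (t *\<^sub>R u - v)) / pnorm p (1, t)"
      unfolding A_set_def by blast
    \<comment> \<open>After \<open>sym\<close> swaps the two arguments, each norm is rewritten in
      terms of \<open>- v\<close>. This substitution is its own inverse, so it also serves the other
      inclusion.\<close>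
    have "x = l (norm (t *\<^sub>R u + - v), norm (u - t *\<^sub>R (- v))) / pnorm p (1, t)"
      unfolding x by (subst sym) simp
    moreover have "- v \<in> sphere 0 1" using uvt by simp
    ultimately show "x \<in> B_set l p X" unfolding B_set_def using uvt by blast
  next
    fix x assume "x \<in> B_set l p X"
    then obtain u v :: 'a and t where uvt: "u \<in> sphere 0 1" "v \<in> sphere 0 1" "0 \<le> t" "t \<le> 1"
      and x: "x = l (norm (t *\<^sub>R u + v), norm (u - t *\<^sub>R v)) / pnorm p (1, t)"
      unfolding B_set_def by blast
    have "x = l (norm (u + t *\<^sub>R (- v)), norm (t *\<^sub>R u - - v)) / pnorm p (1, t)"
      unfolding x by (subst sym) simp
    moreover have "- v \<in> sphere 0 1" using uvt by simp
    ultimately show "x \<in> A_set l p X" unfolding A_set_def using uvt by blast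
  qed
qed

theorem lemma1:
  fixes l :: "real \<times> real \<Rightarrow> real" and p :: ereal
  assumes "dim_at_least 2 TYPE('a::real_normed_vector)"
    and "l \<in> Lambda_class"
    and "1 \<le> p"
  shows "C_const l p TYPE('a) = max (A_const l p TYPE('a)) (B_const l p TYPE('a)) \<and>
    (symmetric_on_quadrant l \<longrightarrow>
      A_const l p TYPE('a) = B_const l p TYPE('a) \<and>
      C_const l p TYPE('a) =
        Sup {l (norm (u + t *\<^sub>R v), norm (t *\<^sub>R u - v)) / pnorm p (1, t) | (u::'a) v t.
          u \<in> sphere 0 1 \<and> v \<in> sphere 0 1 \<and> 0 \<le> t \<and> t \<le> 1})"
proof -
  let ?A = "A_set l p TYPE('a)" and ?B = "B_set l p TYPE('a)"
  have as_Sup: "C_const l p TYPE('a) = Sup (C_set l p TYPE('a))"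
      "A_const l p TYPE('a) = Sup ?A" "B_const l p TYPE('a) = Sup ?B"
    by (simp_all only: C_const_def A_const_def B_const_def C_set_def A_set_def B_set_def)
  obtain w :: 'a where "norm w = 1"
    using dim_at_least_unit_vector[OF assms(1)] by auto
  then have w: "w \<in> sphere 0 1" by simp
  \<comment> \<open>The choice \<open>u = v = w\<close>, \<open>t = 0\<close> only serves to exhibit
    an element.\<close>
  have "l (norm (w + 0 *\<^sub>R w), norm (0 *\<^sub>R w - w)) / pnorm p (1, 0) \<in> ?A"
    unfolding A_set_def using w zero_le_one[where 'a = real] by blast
  moreover have "l (norm (0 *\<^sub>R w + w), norm (w - 0 *\<^sub>R w)) / pnorm p (1, 0) \<in> ?B"
    unfolding B_set_def using w zero_le_one[where 'a = real] by blast
  ultimately have "?A \<noteq> {}" "?B \<noteq> {}" by auto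
  moreover have "bdd_above ?A" "bdd_above ?B"
    unfolding A_set_def B_set_def by (rule bdd_above_AB_const[OF assms(2,3)])+
  \<comment> \<open>Nonemptiness and boundedness of both sets are what
    \<open>cSup_union_distrib\<close> requires to turn the supremum of the union into a
    maximum.\<close>
  ultimately have max: "C_const l p TYPE('a) = max (A_const l p TYPE('a)) (B_const l p TYPE('a))"
    by (simp add: as_Sup C_set_eq_Un[OF assms(2,3)] cSup_union_distrib sup_max)
  show ?thesis
  proof (intro conjI impI)
    show "C_const l p TYPE('a) = max (A_const l p TYPE('a)) (B_const l p TYPE('a))" by (fact max)
    assume "symmetric_on_quadrant l"
    then show AB: "A_const l p TYPE('a) = B_const l p TYPE('a)"
      by (simp add: as_Sup A_set_eq_B_set)
    show "C_const l p TYPE('a) =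
        Sup {l (norm (u + t *\<^sub>R v), norm (t *\<^sub>R u - v)) / pnorm p (1, t) | (u::'a) v t.
          u \<in> sphere 0 1 \<and> v \<in> sphere 0 1 \<and> 0 \<le> t \<and> t \<le> 1}"
      \<comment> \<open>With equal arguments the maximum collapses to \<open>A_const\<close>, whose
        body is the displayed supremum.\<close>
      using max AB by (simp add: A_const_def)
  qed
qed

end
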